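(* Let $f_j=h_j+\overline{g_j}\in\mathcal{S}_{\mathcal H}^0$ $(j=1,2)$ with $f_1\in\mathcal{W}_{\mathcal H}^{-1}\left(\frac{z}{1-z}\right)$ and $f_2\in\mathcal{W}_{\mathcal H}^{1}\left(\frac12\log\frac{1+z}{1-z}\right)$, i.e. $h_1(z)-g_1(z)=\frac{z}{1-z}$ and $h_2(z)+g_2(z)=\frac12\log\frac{1+z}{1-z}$. If the convolution $f_1*f_2$ is locally univalent in $\mathbb D$, then $f_1*f_2$ is convex in the direction of the imaginary axis.
   Context: $\mathbb{D}=\{z\in\mathbb{C}:|z|<1\}$. $\mathcal H$ is the class of complex-valued harmonic functions $f$ in $\mathbb D$ with $f(0)=f_{\bar z}(0)=f_z(0)-1=0$; each is written $f=h+\overline g$ with $h(z)=z+\sum_{n\ge2}a_nz^n$ and $g(z)=\sum_{n\ge2}b_nz^n$ analytic in $\mathbb D$. $\mathcal S_{\mathcal H}^0$ is the subclass of $\mathcal H$ of univalent, sense-preserving functions (sense-preserving and locally univalent means $|g'|<|h'|$ in $\mathbb D$). $\mathcal A$ is the subclass of $\mathcal H$ of analytic functions. For $\phi\in\mathcal A$ and $|\lambda|=1$, $\mathcal W_{\mathcal H}^\lambda(\phi)=\{h+\overline g\in\mathcal H: h+\lambda g=\phi\}$. For $f=h+\overline g$ and $F=H+\overline G$ the convolution is $f*F=h*H+\overline{g*G}$, where $*$ of power series is the Hadamard (coefficientwise) product. The logarithm is the analytic branch vanishing at $z=0$. A domain is convex in the direction of the imaginary axis if its intersection with each vertical line is connected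 or empty; a function on $\mathbb D$ is convex in the direction of the imaginary axis if it maps $\mathbb D$ onto such a domain. *)

theory Defs
  imports "HOL-Complex_Analysis.Complex_Analysis"
begin

abbreviation unit_disc :: "complex set" ("\<bbbD>") where
  "\<bbbD> \<equiv> ball 0 1"

text \<open>Partial derivatives in the real coordinates \<open>x\<close>, \<open>y\<close> of \<open>z = x + \<i>y\<close>, and the
  Wirtinger derivatives. Here \<open>frechet_derivative\<close> is the real-linear derivative.\<close>

definition partial_x :: "(complex \<Rightarrow> complex) \<Rightarrow> complex \<Rightarrow> complex" where
  "partial_x f z = frechet_derivative f (at z) 1"

definition partial_y :: "(complex \<Rightarrow> complex) \<Rightarrow> complex \<Rightarrow> complex" where
  "partial_y f z = frechet_derivative f (at z) \<i>"

definition wirtinger_z :: "(complex \<Rightarrow> complex) \<Rightarrow> complex \<Rightarrow> complex" where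
  "wirtinger_z f z = (partial_x f z - \<i> * partial_y f z) / 2"

definition wirtinger_zbar :: "(complex \<Rightarrow> complex) \<Rightarrow> complex \<Rightarrow> complex" where
  "wirtinger_zbar f z = (partial_x f z + \<i> * partial_y f z) / 2"

text \<open>Twice continuously (real) differentiable with vanishing Laplacian; intended for open \<open>S\<close>.\<close>

definition harmonic_on :: "(complex \<Rightarrow> complex) \<Rightarrow> complex set \<Rightarrow> bool" where
  "harmonic_on f S \<longleftrightarrow>
     (\<forall>z\<in>S. f differentiable (at z) \<and> partial_x f differentiable (at z)
              \<and> partial_y f differentiable (at z)) \<and>
     continuous_on S (partial_x (partial_x f)) \<and> continuous_on S (partial_y (partial_x f)) \<and>
     continuous_on S (partial_x (partial_y f)) \<and> continuous_on S (partial_y (partial_y f)) \<and>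
     (\<forall>z\<in>S. partial_x (partial_x f) z + partial_y (partial_y f) z = 0)"

definition class_H :: "(complex \<Rightarrow> complex) set" where
  "class_H = {f. harmonic_on f \<bbbD> \<and> f 0 = 0 \<and> wirtinger_zbar f 0 = 0 \<and> wirtinger_z f 0 - 1 = 0}"

text \<open>\<open>f = h + cnj g\<close> on the disc with \<open>h(z) = z + \<Sum>\<^sub>n\<^sub>\<ge>\<^sub>2 a\<^sub>n z\<^sup>n\<close> and
  \<open>g(z) = \<Sum>\<^sub>n\<^sub>\<ge>\<^sub>2 b\<^sub>n z\<^sup>n\<close>; on the disc, \<open>h\<close> and \<open>g\<close> are determined by \<open>f\<close>.\<close>

definition canonical_rep ::
    "(complex \<Rightarrow> complex) \<Rightarrow> (complex \<Rightarrow> complex) \<Rightarrow> (complex \<Rightarrow> complex) \<Rightarrow> bool" where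
  "canonical_rep f h g \<longleftrightarrow>
     h analytic_on \<bbbD> \<and> g analytic_on \<bbbD> \<and>
     h 0 = 0 \<and> deriv h 0 = 1 \<and> g 0 = 0 \<and> deriv g 0 = 0 \<and>
     (\<forall>z\<in>\<bbbD>. f z = h z + cnj (g z))"

definition class_SH0 :: "(complex \<Rightarrow> complex) set" where
  "class_SH0 = {f \<in> class_H. inj_on f \<bbbD> \<and>
     (\<exists>h g. canonical_rep f h g \<and> (\<forall>z\<in>\<bbbD>. norm (deriv g z) < norm (deriv h z)))}"

definition class_WH :: "complex \<Rightarrow> (complex \<Rightarrow> complex) \<Rightarrow> (complex \<Rightarrow> complex) set" where
  "class_WH \<mu> \<phi> = {f \<in> class_H.
     \<exists>h g. canonical_rep f h g \<and> (\<forall>z\<in>\<bbbD>. h z + \<mu> * g z = \<phi> z)}"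

definition hadamard_prod ::
    "(complex \<Rightarrow> complex) \<Rightarrow> (complex \<Rightarrow> complex) \<Rightarrow> complex \<Rightarrow> complex" where
  "hadamard_prod p q =
     eval_fps (Abs_fps (\<lambda>n. fps_nth (fps_expansion p 0) n * fps_nth (fps_expansion q 0) n))"

text \<open>The convolution of \<open>h + cnj g\<close> and \<open>H + cnj G\<close>, given through the analytic parts.\<close>

definition harmonic_conv :: "(complex \<Rightarrow> complex) \<Rightarrow> (complex \<Rightarrow> complex) \<Rightarrow>
    (complex \<Rightarrow> complex) \<Rightarrow> (complex \<Rightarrow> complex) \<Rightarrow> complex \<Rightarrow> complex" where
  "harmonic_conv h g H G z = hadamard_prod h H z + cnj (hadamard_prod g G z)"

definition locally_univalent_on :: "(complex \<Rightarrow> complex) \<Rightarrow> complex set \<Rightarrow> bool" where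
  "locally_univalent_on f S \<longleftrightarrow> (\<forall>z\<in>S. \<exists>U. open U \<and> z \<in> U \<and> U \<subseteq> S \<and> inj_on f U)"

text \<open>Note that \<open>connected {}\<close> holds.\<close>

definition domain_convex_imag_dir :: "complex set \<Rightarrow> bool" where
  "domain_convex_imag_dir S \<longleftrightarrow>
     open S \<and> connected S \<and> S \<noteq> {} \<and> (\<forall>x::real. connected (S \<inter> {w. Re w = x}))"

definition convex_imag_dir :: "(complex \<Rightarrow> complex) \<Rightarrow> bool" where
  "convex_imag_dir f \<longleftrightarrow> domain_convex_imag_dir (f ` \<bbbD>)"

end

theory Submission
  imports Defs
begin

text \<open>
  Write \<open>F = H + cnj G\<close> for the convolution and \<open>\<Phi> = H + G\<close>, so that
  \<open>Re F = Re \<Phi>\<close>. Since \<open>F\<close> is locally univalent, its image is open, and the vertical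
  slices of the image are the \<open>F\<close>-images of the level sets of \<open>Re \<Phi>\<close>. It therefore
  suffices that these level sets are connected.

  From \<open>2 (h\<^sub>1 * h\<^sub>2 + g\<^sub>1 * g\<^sub>2) = (h\<^sub>1 - g\<^sub>1) * (h\<^sub>2 - g\<^sub>2) + (h\<^sub>1 + g\<^sub>1) * (h\<^sub>2 + g\<^sub>2)\<close>
  one gets \<open>2 z \<Phi>' = z (h\<^sub>2 - g\<^sub>2)' + (k(z) - k(-z)) / 2\<close> with \<open>k = h\<^sub>1 + g\<^sub>1\<close>, and both
  terms on the right have positive real part after multiplication by \<open>(1 - z\<^sup>2) / z\<close>.
  Hence \<open>Re ((1 - z\<^sup>2) \<Phi>') > 0\<close>.

  Substituting \<open>z = tanh w\<close> yields a function \<open>\<Psi>\<close> on a horizontal strip with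
  \<open>Re \<Psi>' > 0\<close>. Its real part increases along horizontal lines, so each level set is a graph over
  the set of heights \<open>y\<close> at which the level is attained. The supremum (infimum) of
  \<open>Re \<Psi>\<close> along the line at height \<open>y\<close> is either infinite for all \<open>y\<close> or an affine function
  of \<open>y\<close>, so this set of heights is an interval.
\<close>

section \<open>Derivatives along lines, and a Schwarz estimate for positive real part\<close>

lemma has_vector_derivative_along_line:
  fixes f :: "complex \<Rightarrow> complex"
  assumes "(f has_field_derivative D) (at (p + of_real t * v))"
  shows "((\<lambda>t. f (p + of_real t * v)) has_vector_derivative v * D) (at t)"
proof -
  have "((\<lambda>t. p + of_real t * v) has_vector_derivative v) (at t)"
    by (auto intro!: derivative_eq_intros)
  from field_vector_diff_chain_at[OF this assms] show ?thesis by (simp add: o_def)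
qed

lemma Re_has_derivative_along_line:
  fixes f :: "complex \<Rightarrow> complex"
  assumes "(f has_field_derivative D) (at (p + of_real t * v))"
  shows "((\<lambda>t. Re (f (p + of_real t * v))) has_real_derivative Re (v * D)) (at t)"
  using has_vector_derivative_along_line[OF assms]
  by (simp add: has_vector_derivative_complex_iff)

text \<open>Schwarz's lemma for \<open>f\<close>, which rescales the ball to the unit disc and
  follows \<open>P\<close> by the Moebius map taking the right half-plane to the disc and
  \<open>P w\<close> to 0. Its derivative at 0 is
  \<open>r * deriv P w / (2 * Re (P w))\<close>.\<close>

lemma deriv_bound_Re_pos:
  assumes hol: "P holomorphic_on ball w r" and r: "0 < r"
    and pos: "\<And>v. v \<in> ball w r \<Longrightarrow> 0 < Re (P v)"
  shows "norm (deriv P w) \<le> 2 / r * Re (P w)"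
proof -
  define f where "f = (\<lambda>\<zeta>. (P (w + of_real r * \<zeta>) - P w) / (P (w + of_real r * \<zeta>) + cnj (P w)))"
  have mem: "w + of_real r * \<zeta> \<in> ball w r" if "norm \<zeta> < 1" for \<zeta>
    using that r by (simp add: dist_norm norm_mult)
  have w: "w \<in> ball w r" using r by simp
  have nz: "P (w + of_real r * \<zeta>) + cnj (P w) \<noteq> 0" if "norm \<zeta> < 1" for \<zeta>
  proof
    assume "P (w + of_real r * \<zeta>) + cnj (P w) = 0"
    then have "Re (P (w + of_real r * \<zeta>)) + Re (P w) = 0" by (simp add: complex_eq_iff)
    then show False using pos[OF mem[OF that]] pos[OF w] by simp
  qed
  have holc: "(\<lambda>\<zeta>. P (w + of_real r * \<zeta>)) holomorphic_on ball 0 1"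
    using mem
    by (intro holomorphic_on_compose_gen[OF _ hol, unfolded o_def] holomorphic_intros) auto
  have holf: "f holomorphic_on ball 0 1"
    unfolding f_def using nz by (intro holomorphic_intros holc) auto
  have lt: "norm (f \<zeta>) < 1" if "norm \<zeta> < 1" for \<zeta>
  proof -
    let ?a = "P (w + of_real r * \<zeta>)" and ?b = "P w"
    \<comment> \<open>The squared norms of \<open>?a + cnj ?b\<close> and \<open>?a - ?b\<close>
      differ by \<open>4 * Re ?a * Re ?b\<close>.\<close>
    have "0 < Re ?a * Re ?b" using pos[OF mem[OF that]] pos[OF w] by simp
    then have "(norm (?a - ?b))\<^sup>2 < (norm (?a + cnj ?b))\<^sup>2"
      unfolding cmod_power2 by (simp add: power2_eq_square algebra_simps)
    then have "norm (?a - ?b) < norm (?a + cnj ?b)"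
      by (rule power_less_imp_less_base) simp
    moreover have "0 < norm (?a + cnj ?b)" using nz[OF that] by simp
    ultimately show ?thesis unfolding f_def by (simp add: norm_divide)
  qed
  have "f 0 = 0" by (simp add: f_def)
  then have le: "norm (deriv f 0) \<le> 1" using Schwarz_Lemma(2)[OF holf _ lt, of 0] by simp
  have dP: "(P has_field_derivative deriv P w) (at (w + of_real r * 0))"
    using holomorphic_derivI[OF hol _ w] by simp
  have dc: "((\<lambda>\<zeta>. P (w + of_real r * \<zeta>)) has_field_derivative deriv P w * of_real r) (at 0)"
    by (rule DERIV_chain2[where f = P and g = "\<lambda>\<zeta>. w + of_real r * \<zeta>" and x = 0, OF dP]) (auto intro!: derivative_eq_intros)
  have "(f has_field_derivative deriv P w * of_real r / (P w + cnj (P w))) (at 0)"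
    unfolding f_def using nz[of 0]
    by (auto intro!: derivative_eq_intros dc)
  then have "deriv f 0 = deriv P w * of_real r / of_real (2 * Re (P w))"
    by (simp add: DERIV_imp_deriv complex_add_cnj)
  with le have "norm (deriv P w) * r / (2 * Re (P w)) \<le> 1"
    using r pos[OF w] by (simp add: norm_divide norm_mult)
  then show ?thesis using r pos[OF w] by (simp add: field_simps)
qed

definition horizontal_strip :: "real \<Rightarrow> complex set" where
  "horizontal_strip a = {w. \<bar>Im w\<bar> < a}"

lemma Complex_in_horizontal_strip [simp]:
  "Complex x y \<in> horizontal_strip a \<longleftrightarrow> \<bar>y\<bar> < a"
  by (simp add: horizontal_strip_def)

lemma open_horizontal_strip: "open (horizontal_strip a)"
  unfolding horizontal_strip_def by (intro open_Collect_less continuous_intros)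

lemma ball_subset_horizontal_strip:
  assumes "\<bar>y\<bar> \<le> b"
  shows "ball (Complex x y) (a - b) \<subseteq> horizontal_strip a"
proof
  fix v assume "v \<in> ball (Complex x y) (a - b)"
  then have "norm (v - Complex x y) < a - b" by (simp add: dist_norm norm_minus_commute)
  then have "\<bar>Im v - y\<bar> < a - b" using abs_Im_le_cmod[of "v - Complex x y"] by simp
  with assms show "v \<in> horizontal_strip a" by (simp add: horizontal_strip_def)
qed

lemma convex_vertical_segment: "convex {w. Re w = x \<and> \<bar>Im w\<bar> \<le> b}"
proof -
  have "{w. Re w = x \<and> \<bar>Im w\<bar> \<le> b}
      = ({w. Re w \<le> x} \<inter> {w. Re w \<ge> x}) \<inter> ({w. Im w \<le> b} \<inter> {w. Im w \<ge> - b})" by auto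
  then show ?thesis
    by (simp only: convex_Int convex_halfspace_Im_le convex_halfspace_Im_ge
          convex_halfspace_Re_le convex_halfspace_Re_ge)
qed

section \<open>Holomorphic functions on a horizontal strip\<close>

locale Re_pos_strip =
  fixes P :: "complex \<Rightarrow> complex" and a :: real
  assumes hol: "P holomorphic_on horizontal_strip a"
    and pos: "\<And>w. w \<in> horizontal_strip a \<Longrightarrow> 0 < Re (P w)"
begin

lemma norm_deriv_le:
  assumes "\<bar>y\<bar> \<le> b" "b < a"
  shows "norm (deriv P (Complex x y)) \<le> 2 / (a - b) * Re (P (Complex x y))"
  using ball_subset_horizontal_strip[OF assms(1), of x a] assms hol pos
  by (intro deriv_bound_Re_pos) (auto intro: holomorphic_on_subset)

text \<open>Gronwall's argument: along the vertical segment \<open>Re P\<close> satisfies a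
  differential inequality \<open>u' \<le> K * u\<close> by \<open>norm_deriv_le\<close>, so
  \<open>exp (- K * t) * Re (P (q t))\<close> does not increase. The resulting factor does not
  depend on \<open>x\<close>, which later permits limits along the strip.\<close>

lemma Harnack_vertical:
  assumes y1: "\<bar>y1\<bar> \<le> b" and y2: "\<bar>y2\<bar> \<le> b" and "b < a"
  shows "Re (P (Complex x y2)) \<le> exp (4 * b / (a - b)) * Re (P (Complex x y1))"
proof -
  define q where "q = (\<lambda>t::real. Complex x y1 + of_real t * (\<i> * of_real (y2 - y1)))"
  define K where "K = 2 / (a - b) * \<bar>y2 - y1\<bar>"
  have q: "q t = Complex x (y1 + t * (y2 - y1))" for t
    by (simp add: q_def complex_eq_iff)
  have in_b: "\<bar>y1 + t * (y2 - y1)\<bar> \<le> b" if "0 \<le> t" "t \<le> 1" for t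
  proof -
    have "y1 + t * (y2 - y1) = (1 - t) * y1 + t * y2" by (simp add: algebra_simps)
    then have "\<bar>y1 + t * (y2 - y1)\<bar> \<le> (1 - t) * \<bar>y1\<bar> + t * \<bar>y2\<bar>"
      using that abs_triangle_ineq[of "(1-t)*y1" "t*y2"] by (simp add: abs_mult)
    also have "\<dots> \<le> (1 - t) * b + t * b"
      using that y1 y2 by (intro add_mono mult_left_mono) auto
    finally show ?thesis by (simp add: algebra_simps)
  qed
  have "exp (- K * 1) * Re (P (q 1)) \<le> exp (- K * 0) * Re (P (q 0))"
  proof (rule DERIV_nonpos_imp_nonincreasing[where f = "\<lambda>t. exp (- K * t) * Re (P (q t))"])
    fix t :: real assume t: "0 \<le> t" "t \<le> 1"
    have qs: "q t \<in> horizontal_strip a" using in_b[OF t] \<open>b < a\<close> by (simp add: q)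
    let ?D = "\<i> * of_real (y2 - y1) * deriv P (q t)"
    have d: "((\<lambda>t. Re (P (q t))) has_real_derivative Re ?D) (at t)"
      unfolding q_def
      by (rule Re_has_derivative_along_line)
        (use holomorphic_derivI[OF hol open_horizontal_strip qs] in \<open>simp add: q_def\<close>)
    have "Re ?D \<le> norm ?D" by (rule complex_Re_le_cmod)
    also have "\<dots> = \<bar>y2 - y1\<bar> * norm (deriv P (q t))"
      by (simp add: norm_mult del: of_real_diff)
    also have "\<dots> \<le> \<bar>y2 - y1\<bar> * (2 / (a - b) * Re (P (q t)))"
      unfolding q using in_b[OF t] \<open>b < a\<close> by (intro mult_left_mono norm_deriv_le) auto
    finally have "Re ?D \<le> K * Re (P (q t))" by (simp add: K_def mult_ac)
    then have "exp (- K * t) * (Re ?D - K * Re (P (q t))) \<le> 0"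
      by (simp add: mult_nonneg_nonpos)
    moreover have "((\<lambda>t. exp (- K * t) * Re (P (q t))) has_real_derivative
        exp (- K * t) * (Re ?D - K * Re (P (q t)))) (at t)"
    proof -
      have "((\<lambda>t. exp (- K * t)) has_real_derivative - K * exp (- K * t)) (at t)"
        by (auto intro!: derivative_eq_intros)
      from DERIV_mult[OF this d] show ?thesis
        by (rule DERIV_cong) (simp only: algebra_simps)
    qed
    ultimately show "\<exists>y. ((\<lambda>t. exp (- K * t) * Re (P (q t))) has_real_derivative y) (at t) \<and> y \<le> 0"
      by blast
  qed simp
  then have "Re (P (Complex x y2)) \<le> exp K * Re (P (Complex x y1))"
    by (simp add: q exp_minus field_simps)
  also have "\<dots> \<le> exp (4 * b / (a - b)) * Re (P (Complex x y1))"
  proof (rule mult_right_mono)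
    have "K \<le> 2 / (a - b) * (2 * b)"
      unfolding K_def using y1 y2 \<open>b < a\<close> by (intro mult_left_mono) auto
    then show "exp K \<le> exp (4 * b / (a - b))" by (simp add: field_simps)
    show "0 \<le> Re (P (Complex x y1))" using pos[of "Complex x y1"] y1 \<open>b < a\<close> by simp
  qed
  finally show ?thesis .
qed

text \<open>The derivative bound and Harnack's inequality control \<open>deriv P\<close> on the
  whole segment of heights at most \<open>b\<close> by \<open>Re P\<close> at a single point of it;
  the mean value inequality over a length of at most \<open>2 * b\<close> does the rest. Again
  \<open>C\<close> is uniform in \<open>x\<close>.\<close>

lemma vertical_oscillation:
  assumes "0 \<le> b" "b < a"
  obtains C where "0 \<le> C"
    "\<And>x y1 y2. \<bar>y1\<bar> \<le> b \<Longrightarrow> \<bar>y2\<bar> \<le> b \<Longrightarrow>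
       norm (P (Complex x y2) - P (Complex x y1)) \<le> C * Re (P (Complex x y1))"
proof -
  define E where "E = 2 / (a - b) * exp (4 * b / (a - b))"
  have E: "0 \<le> E" using assms by (simp add: E_def)
  have "norm (P (Complex x y2) - P (Complex x y1)) \<le> E * (2 * b) * Re (P (Complex x y1))"
    if y: "\<bar>y1\<bar> \<le> b" "\<bar>y2\<bar> \<le> b" for x y1 y2
  proof -
    let ?T = "{w. Re w = x \<and> \<bar>Im w\<bar> \<le> b}"
    have "norm (P (Complex x y2) - P (Complex x y1))
        \<le> E * Re (P (Complex x y1)) * norm (Complex x y2 - Complex x y1)"
    proof (rule field_differentiable_bound[OF convex_vertical_segment, where f' = "deriv P"])
      fix w assume w: "w \<in> ?T"
      then have wc: "w = Complex x (Im w)" by (simp add: complex_eq_iff)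
      have ws: "w \<in> horizontal_strip a" using w assms by (simp add: horizontal_strip_def)
      then show "(P has_field_derivative deriv P w) (at w within ?T)"
        using holomorphic_derivI[OF hol open_horizontal_strip] by (blast intro: has_field_derivative_at_within)
      have "norm (deriv P w) \<le> 2 / (a - b) * Re (P w)"
        using norm_deriv_le[of "Im w" b x] w assms wc by simp
      also have "\<dots> \<le> 2 / (a - b) * (exp (4 * b / (a - b)) * Re (P (Complex x y1)))"
        using Harnack_vertical[OF y(1), of "Im w" x] w assms wc by (intro mult_left_mono) auto
      finally show "norm (deriv P w) \<le> E * Re (P (Complex x y1))" by (simp add: E_def mult_ac)
    qed (use y in auto)
    also have "norm (Complex x y2 - Complex x y1) = \<bar>y2 - y1\<bar>"
      by (simp add: cmod_def)
    also have "E * Re (P (Complex x y1)) * \<bar>y2 - y1\<bar> \<le> E * Re (P (Complex x y1)) * (2 * b)"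
      using y E pos[of "Complex x y1"] assms by (intro mult_left_mono mult_nonneg_nonneg) auto
    finally show ?thesis by (simp add: mult_ac)
  qed
  moreover have "0 \<le> E * (2 * b)" using E assms by simp
  ultimately show thesis using that by blast
qed

end

section \<open>Level sets of the real part when the derivative has positive real part\<close>

locale Re_deriv_pos_strip =
  fixes \<Psi> :: "complex \<Rightarrow> complex" and a :: real
  assumes hol: "\<Psi> holomorphic_on horizontal_strip a"
    and pos: "\<And>w. w \<in> horizontal_strip a \<Longrightarrow> 0 < Re (deriv \<Psi> w)"
begin

sublocale P: Re_pos_strip "deriv \<Psi>" a
  using hol pos open_horizontal_strip by unfold_locales (auto intro: holomorphic_deriv)

lemma DERIV_horizontal:
  assumes "\<bar>y\<bar> < a"
  shows "((\<lambda>x. Re (\<Psi> (Complex x y))) has_real_derivative Re (deriv \<Psi> (Complex x y))) (at x)"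
proof -
  have eq: "Complex 0 y + of_real t * 1 = Complex t y" for t
    by (simp add: complex_eq_iff)
  show ?thesis
    using Re_has_derivative_along_line[of \<Psi> "deriv \<Psi> (Complex x y)" "Complex 0 y" x 1]
      holomorphic_derivI[OF hol open_horizontal_strip, of "Complex x y"] assms
    unfolding eq by simp
qed

lemma Re_strict_mono:
  assumes "\<bar>y\<bar> < a" "x1 < x2"
  shows "Re (\<Psi> (Complex x1 y)) < Re (\<Psi> (Complex x2 y))"
  using assms(2)
  by (rule DERIV_pos_imp_increasing) (use DERIV_horizontal[OF assms(1)] pos assms in force)

lemma Re_mono:
  assumes "\<bar>y\<bar> < a" "x1 \<le> x2"
  shows "Re (\<Psi> (Complex x1 y)) \<le> Re (\<Psi> (Complex x2 y))"
  using Re_strict_mono[OF assms(1)] assms(2) by (cases "x1 = x2") (auto simp: less_eq_real_def)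

text \<open>By \<open>P.norm_deriv_le\<close> with \<open>b = \<bar>y\<bar>\<close>, the second
  derivative of \<open>\<Psi>\<close> is dominated by a multiple of the slope of
  \<open>Re \<Psi>\<close> along the line. Integrating this makes \<open>deriv \<Psi>\<close> Cauchy
  along any line on which \<open>Re \<Psi>\<close> converges.\<close>

lemma deriv_horizontal_oscillation:
  assumes "\<bar>y\<bar> < a" "x1 < x2"
  shows "norm (deriv \<Psi> (Complex x2 y) - deriv \<Psi> (Complex x1 y))
    \<le> 2 / (a - \<bar>y\<bar>) * (Re (\<Psi> (Complex x2 y)) - Re (\<Psi> (Complex x1 y)))"
proof -
  have eq: "Complex 0 y + of_real t * 1 = Complex t y" for t
    by (simp add: complex_eq_iff)
  have d: "((\<lambda>x. deriv \<Psi> (Complex x y)) has_vector_derivative deriv (deriv \<Psi>) (Complex x y)) (at x)"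
    for x
    using has_vector_derivative_along_line[of "deriv \<Psi>" "deriv (deriv \<Psi>) (Complex x y)" "Complex 0 y" x 1]
      holomorphic_derivI[OF P.hol open_horizontal_strip, of "Complex x y"] assms
    unfolding eq by simp
  have e: "((\<lambda>x. 2 / (a - \<bar>y\<bar>) * Re (\<Psi> (Complex x y))) has_vector_derivative
      2 / (a - \<bar>y\<bar>) * Re (deriv \<Psi> (Complex x y))) (at x)" for x
    using DERIV_cmult[OF DERIV_horizontal[OF assms(1)]]
    unfolding has_real_derivative_iff_has_vector_derivative .
  have "norm (deriv \<Psi> (Complex x2 y) - deriv \<Psi> (Complex x1 y))
    \<le> 2 / (a - \<bar>y\<bar>) * Re (\<Psi> (Complex x2 y)) - 2 / (a - \<bar>y\<bar>) * Re (\<Psi> (Complex x1 y))"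
    using assms(2)
  proof (rule differentiable_bound_general[where f' = "\<lambda>x. deriv (deriv \<Psi>) (Complex x y)"])
    show "continuous_on {x1..x2} (\<lambda>x. deriv \<Psi> (Complex x y))"
      by (intro continuous_at_imp_continuous_on ballI has_vector_derivative_continuous[OF d])
    show "continuous_on {x1..x2} (\<lambda>x. 2 / (a - \<bar>y\<bar>) * Re (\<Psi> (Complex x y)))"
      by (intro continuous_at_imp_continuous_on ballI has_vector_derivative_continuous[OF e])
    show "norm (deriv (deriv \<Psi>) (Complex x y)) \<le> 2 / (a - \<bar>y\<bar>) * Re (deriv \<Psi> (Complex x y))" for x
      by (rule P.norm_deriv_le) (use assms in auto)
  qed (rule d e)+
  then show ?thesis by (simp add: algebra_simps)
qed

text \<open>
  Harnack bounds \<open>\<Psi>''\<close> on every horizontal line by the \<open>x\<close>-derivative of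
  \<open>Re \<Psi>\<close> on one of them. So if \<open>Re \<Psi>\<close> is bounded above on one line, \<open>\<Psi>'\<close>
  tends to a purely imaginary constant to the right, uniformly between any two lines.
\<close>

lemma affine_limit:
  assumes y1: "\<bar>y1\<bar> < a" and bdd: "\<And>x. Re (\<Psi> (Complex x y1)) \<le> B"
  obtains \<alpha> \<beta> where
    "\<And>y. \<bar>y\<bar> < a \<Longrightarrow> (\<lambda>n. Re (\<Psi> (Complex (real n) y))) \<longlonglongrightarrow> \<alpha> + \<beta> * y"
proof -
  define g where "g = (\<lambda>n. Re (\<Psi> (Complex (real n) y1)))"
  define Q where "Q = (\<lambda>n. deriv \<Psi> (Complex (real n) y1))"
  define K where "K = 2 / (a - \<bar>y1\<bar>)"
  have K: "0 < K" using y1 by (simp add: K_def)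
  have "incseq g" by (auto simp: g_def incseq_def intro!: Re_mono y1)
  moreover have "bdd_above (range g)" using bdd by (auto simp: g_def intro!: bdd_aboveI[of _ B])
  ultimately obtain l where l: "g \<longlonglongrightarrow> l" using LIMSEQ_incseq_SUP by blast
  have osc: "norm (Q n - Q m) \<le> K * (g n - g m)" if "m < n" for m n
    unfolding Q_def g_def K_def using that by (intro deriv_horizontal_oscillation y1) auto
  have "Cauchy Q"
  proof (rule CauchyI')
    fix e :: real assume "0 < e"
    then obtain M where M: "\<And>m n. m \<ge> M \<Longrightarrow> n \<ge> M \<Longrightarrow> dist (g m) (g n) < e / K"
      using LIMSEQ_imp_Cauchy[OF l] K unfolding Cauchy_def by (metis divide_pos_pos)
    have "norm (Q m - Q n) < e" if "m \<ge> M" "m < n" for m n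
    proof -
      have "g n - g m < e / K" using M[of m n] that by (simp add: dist_real_def)
      then have "K * (g n - g m) < e" using K by (simp add: field_simps)
      then show ?thesis using osc[of m n] that by (simp add: norm_minus_commute)
    qed
    then show "\<exists>M. \<forall>m\<ge>M. \<forall>n>m. dist (Q m) (Q n) < e" unfolding dist_norm by blast
  qed
  then obtain L where L: "Q \<longlonglongrightarrow> L" using Cauchy_convergent convergent_def by blast
  \<comment> \<open>At some point between \<open>n\<close> and \<open>n + 1\<close> the slope equals
    the increment \<open>g (Suc n) - g n\<close>, and from \<open>n\<close> to that point the
    derivative varies by at most \<open>K\<close> times this increment. Increments of a convergent
    sequence tend to 0.\<close>
  have Q0: "(\<lambda>n. Re (Q n)) \<longlonglongrightarrow> 0"
  proof (rule tendsto_sandwich)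
    show "\<forall>\<^sub>F n in sequentially. 0 \<le> Re (Q n)"
      using pos y1 by (auto simp: Q_def intro!: always_eventually less_imp_le)
    show "\<forall>\<^sub>F n in sequentially. Re (Q n) \<le> (1 + K) * (g (Suc n) - g n)"
    proof (intro always_eventually allI)
      fix n
      obtain z where z: "real n < z" "z < real (Suc n)"
        "g (Suc n) - g n = (real (Suc n) - real n) * Re (deriv \<Psi> (Complex z y1))"
        unfolding g_def using MVT2[of "real n" "real (Suc n)"] DERIV_horizontal[OF y1] by force
      have "Re (Q n) - Re (deriv \<Psi> (Complex z y1)) \<le> norm (deriv \<Psi> (Complex z y1) - Q n)"
        using abs_Re_le_cmod[of "deriv \<Psi> (Complex z y1) - Q n"] by simp
      also have "\<dots> \<le> K * (Re (\<Psi> (Complex z y1)) - g n)"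
        unfolding Q_def g_def K_def using z by (intro deriv_horizontal_oscillation y1) auto
      also have "\<dots> \<le> K * (g (Suc n) - g n)"
        using K Re_mono[OF y1, of z "real (Suc n)"] z by (simp add: g_def)
      finally show "Re (Q n) \<le> (1 + K) * (g (Suc n) - g n)" using z(3) by (simp add: algebra_simps)
    qed
    have "(\<lambda>n. (1 + K) * (g (Suc n) - g n)) \<longlonglongrightarrow> (1 + K) * (l - l)"
      by (intro tendsto_intros LIMSEQ_Suc l)
    then show "(\<lambda>n. (1 + K) * (g (Suc n) - g n)) \<longlonglongrightarrow> 0" by simp
  qed simp
  show thesis
  \<comment> \<open>Moving up by \<open>y - y1\<close> adds asymptotically
    \<open>\<i> * (y - y1) * L\<close> to \<open>\<Psi>\<close>, so the limit at height
    \<open>y\<close> is \<open>l - (y - y1) * Im L\<close>.\<close>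
  proof (rule that[of "l + y1 * Im L" "- Im L"])
    fix y assume y: "\<bar>y\<bar> < a"
    define b where "b = max \<bar>y\<bar> \<bar>y1\<bar>"
    have b: "0 \<le> b" "b < a" "\<bar>y\<bar> \<le> b" "\<bar>y1\<bar> \<le> b" using y y1 by (auto simp: b_def)
    obtain C where C: "0 \<le> C"
      "\<And>x y1 y2. \<bar>y1\<bar> \<le> b \<Longrightarrow> \<bar>y2\<bar> \<le> b \<Longrightarrow>
       norm (deriv \<Psi> (Complex x y2) - deriv \<Psi> (Complex x y1)) \<le> C * Re (deriv \<Psi> (Complex x y1))"
      using P.vertical_oscillation[OF b(1,2)] by blast
    \<comment> \<open>\<open>R n\<close> is the error of the linear approximation in the vertical
      direction. The mean value inequality for \<open>\<Psi> w - w * Q n\<close> bounds it by a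
      multiple of \<open>Re (Q n)\<close>, which tends to 0 by \<open>Q0\<close>.\<close>
    define R where "R = (\<lambda>n. \<Psi> (Complex (real n) y) - \<Psi> (Complex (real n) y1) - \<i> * of_real (y - y1) * Q n)"
    have R: "norm (R n) \<le> C * Re (Q n) * \<bar>y - y1\<bar>" for n
    proof -
      let ?T = "{w. Re w = real n \<and> \<bar>Im w\<bar> \<le> b}"
      have "norm ((\<Psi> (Complex n y) - Complex n y * Q n) - (\<Psi> (Complex n y1) - Complex n y1 * Q n))
        \<le> C * Re (Q n) * norm (Complex n y - Complex n y1)"
      proof (rule field_differentiable_bound[OF convex_vertical_segment, where f' = "\<lambda>w. deriv \<Psi> w - Q n"])
        fix w assume w: "w \<in> ?T"
        then have wc: "w = Complex n (Im w)" by (simp add: complex_eq_iff)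
        have "w \<in> horizontal_strip a" using w b by (simp add: horizontal_strip_def)
        then have "(\<Psi> has_field_derivative deriv \<Psi> w) (at w)"
          using holomorphic_derivI[OF hol open_horizontal_strip] by blast
        then show "((\<lambda>w. \<Psi> w - w * Q n) has_field_derivative deriv \<Psi> w - Q n) (at w within ?T)"
          using DERIV_diff[OF has_field_derivative_at_within DERIV_cmult_right[OF DERIV_ident]] by fastforce
        show "norm (deriv \<Psi> w - Q n) \<le> C * Re (Q n)"
          using C(2)[of y1 "Im w" n] w b wc by (simp add: Q_def)
      qed (use b in auto)
      moreover have "Complex n y - Complex n y1 = \<i> * of_real (y - y1)"
        by (simp add: complex_eq_iff)
      moreover have "\<Psi> (Complex n y) - Complex n y * Q n - (\<Psi> (Complex n y1) - Complex n y1 * Q n)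
          = \<Psi> (Complex n y) - \<Psi> (Complex n y1) - (Complex n y - Complex n y1) * Q n"
        by (simp add: algebra_simps)
      ultimately show ?thesis
        unfolding R_def by (simp add: norm_mult del: of_real_diff)
    qed
    have "(\<lambda>n. C * Re (Q n) * \<bar>y - y1\<bar>) \<longlonglongrightarrow> C * 0 * \<bar>y - y1\<bar>"
      by (intro tendsto_intros Q0)
    then have "R \<longlonglongrightarrow> 0" using R by (intro Lim_null_comparison[of R]) auto
    then have "(\<lambda>n. Re (R n) + g n - (y - y1) * Im (Q n)) \<longlonglongrightarrow> Re 0 + l - (y - y1) * Im L"
      by (intro tendsto_intros l L)
    moreover have "Re (R n) + g n - (y - y1) * Im (Q n) = Re (\<Psi> (Complex (real n) y))" for n
      by (simp add: R_def g_def algebra_simps)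
    ultimately show "(\<lambda>n. Re (\<Psi> (Complex (real n) y))) \<longlonglongrightarrow> l + y1 * Im L + - Im L * y"
      by (simp add: algebra_simps)
  qed
qed

text \<open>If some line stays at or below \<open>c\<close>, then \<open>affine_limit\<close>
  applies to every line. By monotonicity the limit is the supremum of \<open>Re \<Psi>\<close> on
  that line, so the heights in question are those with
  \<open>c < \<alpha> + \<beta> * y\<close>.\<close>

lemma is_interval_exceeding_lines: "is_interval {y. \<bar>y\<bar> < a \<and> (\<exists>x. c < Re (\<Psi> (Complex x y)))}"
proof (cases "\<forall>y. \<bar>y\<bar> < a \<longrightarrow> (\<exists>x. c < Re (\<Psi> (Complex x y)))")
  case True
  then have "{y. \<bar>y\<bar> < a \<and> (\<exists>x. c < Re (\<Psi> (Complex x y)))} = {-a<..<a}" by auto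
  then show ?thesis by (simp add: is_interval_oo)
next
  case False
  then obtain y1 where "\<bar>y1\<bar> < a" "\<And>x. Re (\<Psi> (Complex x y1)) \<le> c" by (auto simp: not_less)
  then obtain \<alpha> \<beta> where lim:
    "\<And>y. \<bar>y\<bar> < a \<Longrightarrow> (\<lambda>n. Re (\<Psi> (Complex (real n) y))) \<longlonglongrightarrow> \<alpha> + \<beta> * y"
    using affine_limit by metis
  have iff: "(\<exists>x. c < Re (\<Psi> (Complex x y))) \<longleftrightarrow> c < \<alpha> + \<beta> * y" if y: "\<bar>y\<bar> < a" for y
  proof
    assume "\<exists>x. c < Re (\<Psi> (Complex x y))"
    then obtain x where x: "c < Re (\<Psi> (Complex x y))" by blast
    obtain N where N: "x \<le> real N" using real_arch_simple by blast
    have "Re (\<Psi> (Complex (real N) y)) \<le> \<alpha> + \<beta> * y"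
      by (rule incseq_le[OF _ lim[OF y]]) (auto simp: incseq_def intro!: Re_mono y)
    then show "c < \<alpha> + \<beta> * y" using x Re_mono[OF y N] by simp
  next
    assume "c < \<alpha> + \<beta> * y"
    then have "\<forall>\<^sub>F n in sequentially. c < Re (\<Psi> (Complex (real n) y))"
      using lim[OF y] by (simp add: order_tendsto_iff)
    then show "\<exists>x. c < Re (\<Psi> (Complex x y))"
      by (auto simp: eventually_sequentially)
  qed
  have "c < \<alpha> + \<beta> * y" if "c < \<alpha> + \<beta> * p" "c < \<alpha> + \<beta> * q" "p \<le> y" "y \<le> q" for p q y
  proof (cases "0 \<le> \<beta>")
    case True
    then show ?thesis using mult_left_mono[OF that(3) True] that(1) by simp
  next
    case False
    then have "\<beta> * q \<le> \<beta> * y" using that(4) by (intro mult_left_mono_neg) auto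
    then show ?thesis using that(2) by simp
  qed
  moreover have "\<bar>y\<bar> < a" if "\<bar>p\<bar> < a" "\<bar>q\<bar> < a" "p \<le> y" "y \<le> q" for p q y
    using that by linarith
  ultimately have "is_interval {y. \<bar>y\<bar> < a \<and> c < \<alpha> + \<beta> * y}"
    unfolding is_interval_1 by blast
  then show ?thesis using iff by (simp cong: conj_cong)
qed

text \<open>Passing to \<open>- \<Psi> (- w)\<close> preserves the hypotheses and turns falling
  below \<open>c\<close> at height \<open>y\<close> into exceeding \<open>- c\<close> at height
  \<open>- y\<close>.\<close>

lemma is_interval_subceeding_lines: "is_interval {y. \<bar>y\<bar> < a \<and> (\<exists>x. Re (\<Psi> (Complex x y)) < c)}"
proof -
  have neg: "- w \<in> horizontal_strip a" if "w \<in> horizontal_strip a" for w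
    using that by (simp add: horizontal_strip_def)
  have d: "((\<lambda>w. - \<Psi> (- w)) has_field_derivative deriv \<Psi> (- w)) (at w)"
    if "w \<in> horizontal_strip a" for w
    using DERIV_minus[OF DERIV_chain2[OF holomorphic_derivI[OF hol open_horizontal_strip neg[OF that]]
      DERIV_minus[OF DERIV_ident]]] by simp
  interpret N: Re_deriv_pos_strip "\<lambda>w. - \<Psi> (- w)" a
  proof
    show "(\<lambda>w. - \<Psi> (- w)) holomorphic_on horizontal_strip a"
      using d by (meson holomorphic_onI has_field_derivative_at_within field_differentiable_def)
    show "0 < Re (deriv (\<lambda>w. - \<Psi> (- w)) w)" if "w \<in> horizontal_strip a" for w
      using DERIV_imp_deriv[OF d[OF that]] pos[OF neg[OF that]] by simp
  qed
  have "- Complex x y = Complex (- x) (- y)" for x y by (simp add: complex_eq_iff)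
  then have "{y. \<bar>y\<bar> < a \<and> (\<exists>x. - c < Re (- \<Psi> (- Complex x y)))}
      = uminus ` {y. \<bar>y\<bar> < a \<and> (\<exists>x. Re (\<Psi> (Complex x y)) < c)}"
    by (auto simp: image_iff) (metis abs_minus_cancel minus_minus)+
  then have "is_interval (uminus ` {y. \<bar>y\<bar> < a \<and> (\<exists>x. Re (\<Psi> (Complex x y)) < c)})"
    using N.is_interval_exceeding_lines[of "- c"] by simp
  then show ?thesis by simp
qed

text \<open>By strict monotonicity each horizontal line meets the level set at most once, so the
  level set is the graph of a function \<open>X\<close> over the set \<open>J\<close> of heights at
  which values on both sides of \<open>c\<close> occur. \<open>J\<close> is an interval by the two
  preceding lemmas, and \<open>X\<close> is continuous.\<close>

lemma connected_Re_level_set: "connected {w \<in> horizontal_strip a. Re (\<Psi> w) = c}"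
proof -
  define g where "g = (\<lambda>x y. Re (\<Psi> (Complex x y)))"
  define J where "J = {y. \<bar>y\<bar> < a \<and> (\<exists>x. g x y < c)} \<inter> {y. \<bar>y\<bar> < a \<and> (\<exists>x. c < g x y)}"
  have J: "connected J"
    unfolding J_def g_def
    by (intro is_interval_connected is_interval_Int is_interval_subceeding_lines
          is_interval_exceeding_lines)
  have cont: "isCont (\<lambda>y. g x y) y" if "\<bar>y\<bar> < a" for x y
  proof -
    have eq: "Complex x y = of_real x + \<i> * of_real y" for x y by (simp add: complex_eq_iff)
    have "isCont \<Psi> (Complex x y)"
      using that holomorphic_on_imp_continuous_on[OF hol] open_horizontal_strip
      by (simp add: continuous_on_eq_continuous_at)
    then have "isCont (\<lambda>y. \<Psi> (of_real x + \<i> * of_real y)) y"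
      unfolding eq by (rule isCont_o2[where g = \<Psi>, rotated]) (intro continuous_intros)
    then show ?thesis unfolding g_def eq by (rule isCont_Re)
  qed
  have "\<exists>x. g x y = c" if yJ: "y \<in> J" for y
  proof -
    obtain x1 x2 where x: "g x1 y < c" "c < g x2 y" and y: "\<bar>y\<bar> < a"
      using yJ unfolding J_def by blast
    have "x1 \<le> x2" using x Re_mono[OF y, of x2 x1] unfolding g_def by linarith
    moreover have "continuous_on {x1..x2} (\<lambda>x. g x y)"
      unfolding g_def
      by (intro continuous_at_imp_continuous_on ballI DERIV_isCont[OF DERIV_horizontal[OF y]])
    ultimately show ?thesis
      using IVT'[of "\<lambda>x. g x y" x1 c x2] x by force
  qed
  then obtain X where X: "\<And>y. y \<in> J \<Longrightarrow> g (X y) y = c" by metis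
  have "continuous_on J X"
    unfolding continuous_on_iff
  proof (intro ballI allI impI)
    fix y e :: real assume y: "y \<in> J" and e: "0 < e"
    have ya: "\<bar>y\<bar> < a" using y by (simp add: J_def)
    \<comment> \<open>These strict inequalities persist at nearby heights by continuity in the
      height; monotonicity then traps \<open>X y'\<close> between \<open>X y - e\<close> and
      \<open>X y + e\<close>.\<close>
    have "g (X y - e) y < c" "c < g (X y + e) y"
      using X[OF y] Re_strict_mono[OF ya, of "X y - e" "X y"] Re_strict_mono[OF ya, of "X y" "X y + e"] e
      by (auto simp: g_def)
    moreover have "(\<lambda>y'. g (X y - e) y') \<midarrow>y\<rightarrow> g (X y - e) y" "(\<lambda>y'. g (X y + e) y') \<midarrow>y\<rightarrow> g (X y + e) y"
      using cont[OF ya] by (auto simp: isCont_def)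
    ultimately have "\<forall>\<^sub>F y' in at y. g (X y - e) y' < c \<and> c < g (X y + e) y'"
      by (simp add: order_tendsto_iff eventually_conj_iff)
    then obtain d where d: "0 < d"
      "\<And>y'. y' \<noteq> y \<Longrightarrow> dist y' y < d \<Longrightarrow> g (X y - e) y' < c \<and> c < g (X y + e) y'"
      by (auto simp: eventually_at)
    have "dist (X y') (X y) < e" if y': "y' \<in> J" "dist y' y < d" for y'
    proof (cases "y' = y")
      case False
      have ya': "\<bar>y'\<bar> < a" using y' by (simp add: J_def)
      have "g (X y - e) y' < g (X y') y'" "g (X y') y' < g (X y + e) y'"
        using d(2)[OF False y'(2)] X[OF y'(1)] by auto
      then have "X y - e < X y'" "X y' < X y + e"
        using Re_mono[OF ya', of "X y'" "X y - e"] Re_mono[OF ya', of "X y + e" "X y'"]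
        unfolding g_def by linarith+
      then show ?thesis by (simp add: dist_real_def)
    qed (use e in simp)
    then show "\<exists>d>0. \<forall>y'\<in>J. dist y' y < d \<longrightarrow> dist (X y') (X y) < e" using d(1) by blast
  qed
  then have "continuous_on J (\<lambda>y. of_real (X y) + \<i> * of_real y)" by (intro continuous_intros)
  then have "connected ((\<lambda>y. of_real (X y) + \<i> * of_real y) ` J)"
    using J connected_continuous_image by blast
  moreover have "(\<lambda>y. of_real (X y) + \<i> * of_real y) ` J = {w \<in> horizontal_strip a. Re (\<Psi> w) = c}"
  proof (intro equalityI subsetI)
    fix w assume "w \<in> (\<lambda>y. of_real (X y) + \<i> * of_real y) ` J"
    then obtain y where y: "y \<in> J" "w = Complex (X y) y" by (auto simp: complex_eq_iff)
    then show "w \<in> {w \<in> horizontal_strip a. Re (\<Psi> w) = c}"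
      using X[OF y(1)] by (simp add: g_def J_def)
  next
    fix w assume w: "w \<in> {w \<in> horizontal_strip a. Re (\<Psi> w) = c}"
    define x y where "x = Re w" and "y = Im w"
    have wxy: "w = Complex x y" by (simp add: x_def y_def complex_eq_iff)
    have y: "\<bar>y\<bar> < a" and c: "g x y = c" using w by (simp_all add: wxy g_def)
    \<comment> \<open>A step to either side along the line gives values on both sides of
      \<open>c\<close>, so the height lies in \<open>J\<close>.\<close>
    have "g (x - 1) y < c" "c < g (x + 1) y"
      using Re_strict_mono[OF y, of "x - 1" x] Re_strict_mono[OF y, of x "x + 1"] c by (auto simp: g_def)
    then have yJ: "y \<in> J" using y by (auto simp: J_def)
    have "X y = x"
      using Re_strict_mono[OF y, of x "X y"] Re_strict_mono[OF y, of "X y" x] X[OF yJ] c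
      unfolding g_def by (cases x "X y" rule: linorder_cases) auto
    then have "w = of_real (X y) + \<i> * of_real y" using wxy by (simp add: complex_eq_iff)
    then show "w \<in> (\<lambda>y. of_real (X y) + \<i> * of_real y) ` J" using yJ by blast
  qed
  ultimately show ?thesis by simp
qed

end

section \<open>From the strip to the disc\<close>

lemma Cayley_Re_pos:
  fixes z :: complex
  assumes "norm z < 1"
  shows "0 < Re ((1 + z) / (1 - z))"
proof -
  have "z \<noteq> 1" using assms by auto
  then have "0 < (norm (1 - z))\<^sup>2" by simp
  moreover have "0 < 1 - (norm z)\<^sup>2" using assms by (simp add: abs_square_less_1)
  then have "0 < Re ((1 + z) * cnj (1 - z))"
    unfolding cmod_power2 by (simp add: power2_eq_square algebra_simps)
  ultimately show ?thesis
    by (simp add: Re_complex_div_gt_0)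
qed

lemma norm_Cayley_less_1:
  fixes E :: complex
  assumes "0 < Re E"
  shows "norm ((E - 1) / (E + 1)) < 1"
proof -
  have "(norm (E - 1))\<^sup>2 < (norm (E + 1))\<^sup>2"
    unfolding cmod_power2 using assms by (simp add: power2_eq_square algebra_simps)
  then have "norm (E - 1) < norm (E + 1)" by (rule power_less_imp_less_base) simp
  then show ?thesis by (simp add: norm_divide divide_less_eq)
qed

lemma tanh_Cayley:
  fixes w :: complex
  shows "tanh w = (exp (2 * w) - 1) / (exp (2 * w) + 1)"
proof -
  have e: "exp (2 * w) = exp w * exp w" by (simp only: mult_2 exp_add)
  have "tanh w = (exp w * (exp w - exp (- w))) / (exp w * (exp w + exp (- w)))"
    by (simp add: tanh_altdef)
  also have "exp w * (exp w - exp (- w)) = exp (2 * w) - 1"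
    unfolding e by (simp add: right_diff_distrib exp_minus_inverse)
  also have "exp w * (exp w + exp (- w)) = exp (2 * w) + 1"
    unfolding e by (simp add: distrib_left exp_minus_inverse)
  finally show ?thesis .
qed

lemma Re_exp_double_pos:
  assumes "w \<in> horizontal_strip (pi / 4)"
  shows "0 < Re (exp (2 * w))"
proof -
  have "\<bar>2 * Im w\<bar> < pi / 2" using assms by (simp add: horizontal_strip_def)
  then have "0 < cos (2 * Im w)" by (intro cos_gt_zero_pi) auto
  then show ?thesis by (simp add: Re_exp)
qed

text \<open>The map \<open>exp (2 * w)\<close> takes the strip of half-width \<open>pi / 4\<close>
  to the right half-plane, and the Cayley map in \<open>tanh_Cayley\<close> takes that to the disc.
  A preimage of \<open>z\<close> is \<open>Ln ((1 + z) / (1 - z)) / 2\<close>.\<close>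

lemma tanh_horizontal_strip: "tanh ` horizontal_strip (pi / 4) = \<bbbD>"
proof (intro equalityI subsetI)
  fix z assume "z \<in> tanh ` horizontal_strip (pi / 4)"
  then show "z \<in> \<bbbD>"
    using norm_Cayley_less_1[OF Re_exp_double_pos] by (auto simp: tanh_Cayley)
next
  fix z assume z: "z \<in> \<bbbD>"
  define q where "q = (1 + z) / (1 - z)"
  have q: "0 < Re q" using Cayley_Re_pos[of z] z by (simp add: q_def)
  then have q0: "q \<noteq> 0" by auto
  have z1: "1 - z \<noteq> 0" using z by auto
  define w where "w = Ln q / 2"
  have "w \<in> horizontal_strip (pi / 4)"
    using Re_Ln_pos_lt[OF q0] q by (simp add: w_def horizontal_strip_def)
  moreover have "tanh w = z"
  proof -
    have "tanh w = (q - 1) / (q + 1)" using q0 by (simp add: tanh_Cayley w_def)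
    moreover have "q - 1 = 2 * z / (1 - z)" "q + 1 = 2 / (1 - z)" using z1 by (simp_all add: q_def field_simps)
    ultimately show ?thesis using z1 by simp
  qed
  ultimately show "z \<in> tanh ` horizontal_strip (pi / 4)" by blast
qed

lemma has_field_derivative_tanh_strip:
  assumes "w \<in> horizontal_strip (pi / 4)"
  shows "(tanh has_field_derivative 1 - (tanh w)\<^sup>2) (at w)"
proof -
  \<comment> \<open>A zero of \<open>cosh\<close> would force \<open>exp (2 * w) = - 1\<close>,
    outside the right half-plane.\<close>
  have "cosh w \<noteq> 0"
  proof
    assume "cosh w = 0"
    then have "exp w + exp (- w) = 0" by (simp add: cosh_def)
    then have "exp w * exp w = - 1" by (simp add: exp_minus field_simps add_eq_0_iff)
    moreover have "exp (2 * w) = exp w * exp w" by (simp only: mult_2 exp_add)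
    ultimately have "Re (exp (2 * w)) = - 1" by simp
    then show False using Re_exp_double_pos[OF assms] by simp
  qed
  then show ?thesis using has_field_derivative_tanh[OF _ DERIV_ident] by simp
qed

text \<open>
  In the coordinate \<open>u = z / (1 - z)\<close>, which maps the disc onto a half-plane, the expression is the
  average of \<open>dk/du\<close> over the segment from \<open>u(-z)\<close> to \<open>u(z)\<close>, of length vector
  \<open>2 z / (1 - z\<^sup>2)\<close>.
\<close>

lemma Re_odd_part_pos:
  assumes hol: "k holomorphic_on \<bbbD>"
    and pos: "\<And>z. z \<in> \<bbbD> \<Longrightarrow> 0 < Re ((1 - z)\<^sup>2 * deriv k z)"
    and z: "z \<in> \<bbbD>" "z \<noteq> 0"
  shows "0 < Re ((1 - z\<^sup>2) * (k z - k (- z)) / (2 * z))"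
proof -
  \<comment> \<open>\<open>U\<close> is the image of the disc under \<open>z / (1 - z)\<close>, with
    inverse \<open>u / (1 + u)\<close>.\<close>
  define U where "U = {u::complex. Re u > - 1 / 2}"
  have n1: "1 + u \<noteq> 0" if "u \<in> U" for u
  proof
    assume "1 + u = 0"
    then have "u = - 1" by (simp add: add_eq_0_iff)
    then show False using that by (simp add: U_def)
  qed
  have inD: "u / (1 + u) \<in> \<bbbD>" if "u \<in> U" for u
  proof -
    have "(1 + 2 * u - 1) / (1 + 2 * u + 1) = 2 * u / (2 * (1 + u))" by (simp add: algebra_simps)
    also have "\<dots> = u / (1 + u)" by (rule mult_divide_mult_cancel_left) simp
    finally show ?thesis using norm_Cayley_less_1[of "1 + 2 * u"] that by (simp add: U_def)
  qed
  define K where "K = (\<lambda>u. k (u / (1 + u)))"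
  \<comment> \<open>This is \<open>dk/du\<close>: at \<open>z = u / (1 + u)\<close> the factor
    \<open>(1 - z)\<^sup>2\<close> from the hypothesis equals \<open>dz/du\<close>.\<close>
  define D where "D = (\<lambda>u. (1 - u / (1 + u))\<^sup>2 * deriv k (u / (1 + u)))"
  have dK: "(K has_field_derivative D u) (at u)" if u: "u \<in> U" for u
  proof -
    have "((\<lambda>u. u / (1 + u)) has_field_derivative (1 - u / (1 + u))\<^sup>2) (at u)"
      using n1[OF u] by (auto intro!: derivative_eq_intros simp: field_simps power2_eq_square)
    from DERIV_chain2[OF holomorphic_derivI[OF hol open_ball inD[OF u]] this] show ?thesis
      by (simp only: K_def D_def mult.commute)
  qed
  have memU: "x / (1 - x) \<in> U" "x / (1 - x) / (1 + x / (1 - x)) = x" if "x \<in> \<bbbD>" for x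
  proof -
    have x1: "1 - x \<noteq> 0" using that by auto
    then have "2 * (x / (1 - x)) + 1 = (1 + x) / (1 - x)" by (simp add: field_simps)
    then have "0 < Re (2 * (x / (1 - x)) + 1)" using Cayley_Re_pos[of x] that by simp
    then have "0 < 2 * Re (x / (1 - x)) + 1"
      by (simp only: one_complex.sel mult_2 plus_complex.sel)
    then show "x / (1 - x) \<in> U" unfolding U_def by simp
    show "x / (1 - x) / (1 + x / (1 - x)) = x" using x1 by (simp add: field_simps)
  qed
  define p where "p = - z / (1 - - z)"
  define v where "v = z / (1 - z) - p"
  have z1: "1 - z \<noteq> 0" "1 + z \<noteq> 0" using z by (auto simp: add_eq_0_iff)
  have fac: "1 - z\<^sup>2 = (1 - z) * (1 + z)" by (simp add: power2_eq_square algebra_simps)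
  have v: "v = 2 * z / (1 - z\<^sup>2)"
    using z1 unfolding fac v_def p_def by (simp add: field_simps)
  have v0: "v \<noteq> 0" using z z1 unfolding v fac by simp
  have pU: "p \<in> U" using memU(1)[of "- z"] z by (simp add: p_def)
  have pvU: "p + v \<in> U" using memU(1)[of z] z by (simp add: v_def)
  have cU: "convex U" unfolding U_def by (rule convex_halfspace_Re_gt)
  \<comment> \<open>Dividing by \<open>v\<close> cancels the direction factor, so the derivative in
    \<open>t\<close> is \<open>Re D\<close>, which is positive; convexity of \<open>U\<close> keeps
    the segment inside.\<close>
  have "Re (K (p + of_real 0 * v) / v) < Re (K (p + of_real 1 * v) / v)"
  proof (rule DERIV_pos_imp_increasing[where f = "\<lambda>t. Re (K (p + of_real t * v) / v)"])
    fix t :: real assume t: "0 \<le> t" "t \<le> 1"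
    have "(1 - t) *\<^sub>R p + t *\<^sub>R (p + v) \<in> U"
      using cU pU pvU t by (intro convexD) auto
    then have inU: "p + of_real t * v \<in> U" by (simp add: scaleR_conv_of_real algebra_simps)
    have "((\<lambda>u. K u / v) has_field_derivative D (p + of_real t * v) / v) (at (p + of_real t * v))"
      by (intro DERIV_cdivide dK inU)
    from Re_has_derivative_along_line[OF this]
    have "((\<lambda>t. Re (K (p + of_real t * v) / v)) has_real_derivative Re (D (p + of_real t * v))) (at t)"
      using v0 by simp
    moreover have "0 < Re (D (p + of_real t * v))" unfolding D_def by (rule pos[OF inD[OF inU]])
    ultimately show "\<exists>y. ((\<lambda>t. Re (K (p + of_real t * v) / v)) has_real_derivative y) (at t) \<and> 0 < y"
      by blast
  qed simp
  moreover have "K p = k (- z)" using memU(2)[of "- z"] z unfolding K_def p_def by simp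
  moreover have "K (p + v) = k z" using memU(2)[of z] z unfolding K_def v_def by simp
  ultimately have "0 < Re ((k z - k (- z)) / v)" by (simp add: diff_divide_distrib)
  then show ?thesis by (simp add: v mult_ac)
qed

text \<open>Open mapping: the image of a nonconstant \<open>f\<close> would contain a neighbourhood
  of 0, hence nonreal points.\<close>

lemma real_valued_holomorphic_eq_0:
  assumes hol: "f holomorphic_on \<bbbD>" and "f 0 = 0" and re: "\<And>z. z \<in> \<bbbD> \<Longrightarrow> Im (f z) = 0"
    and "z \<in> \<bbbD>"
  shows "f z = 0"
proof (rule ccontr)
  assume "f z \<noteq> 0"
  then have "\<not> f constant_on \<bbbD>"
    unfolding constant_on_def using assms by (metis centre_in_ball zero_less_one)
  then have "open (f ` \<bbbD>)"
    using open_mapping_thm[OF hol, of \<bbbD>] by simp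
  moreover have "0 \<in> f ` \<bbbD>" using \<open>f 0 = 0\<close> by force
  ultimately obtain e where e: "0 < e" "ball 0 e \<subseteq> f ` \<bbbD>" by (auto simp: open_contains_ball)
  then have "\<i> * of_real (e / 2) \<in> f ` \<bbbD>" by (intro subsetD[OF e(2)]) (simp add: norm_mult)
  then obtain w where "w \<in> \<bbbD>" "f w = \<i> * of_real (e / 2)" by auto
  then have "Im (\<i> * of_real (e / 2)) = 0" using re by metis
  then show False using e(1) by simp
qed

text \<open>The differences satisfy \<open>A = cnj B\<close>, so \<open>A + B\<close> and
  \<open>\<i> * (A - B)\<close> are real-valued and holomorphic and vanish at 0. This transfers the
  properties that \<open>class_SH0\<close> and \<open>class_WH\<close> assert for some
  representation to the given one.\<close>

lemma canonical_rep_unique: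
  assumes "canonical_rep f h g" "canonical_rep f h' g'" "z \<in> \<bbbD>"
  shows "h z = h' z" "g z = g' z"
proof -
  define A B where "A = (\<lambda>z. h z - h' z)" and "B = (\<lambda>z. g' z - g z)"
  have hol: "A holomorphic_on \<bbbD>" "B holomorphic_on \<bbbD>"
    using assms unfolding A_def B_def canonical_rep_def
    by (auto intro!: analytic_imp_holomorphic analytic_on_diff)
  have eq: "A z = cnj (B z)" if "z \<in> \<bbbD>" for z
  proof -
    have "h z + cnj (g z) = h' z + cnj (g' z)" using assms that unfolding canonical_rep_def by metis
    then show ?thesis by (simp add: A_def B_def algebra_simps)
  qed
  have "A 0 = 0" "B 0 = 0" using assms by (auto simp: A_def B_def canonical_rep_def)
  then have "A z + B z = 0"
    by - (rule real_valued_holomorphic_eq_0[OF holomorphic_on_add[OF hol] _ _ \<open>z \<in> \<bbbD>\<close>], simp_all add: eq)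
  moreover have "\<i> * (A z - B z) = 0"
    using \<open>A 0 = 0\<close> \<open>B 0 = 0\<close>
    by - (rule real_valued_holomorphic_eq_0[OF holomorphic_on_mult[OF holomorphic_on_const
          holomorphic_on_diff[OF hol]] _ _ \<open>z \<in> \<bbbD>\<close>], simp_all add: eq)
  ultimately show "h z = h' z" "g z = g' z" by (auto simp: A_def B_def)
qed

text \<open>The derivative of \<open>tanh\<close> is \<open>1 - (tanh w)\<^sup>2\<close>, so the
  weight \<open>1 - z\<^sup>2\<close> is what the substitution \<open>z = tanh w\<close> produces.
  The level set is then the continuous image of a connected level set in the strip.\<close>

lemma connected_Re_level_disc:
  assumes hol: "\<Phi> holomorphic_on \<bbbD>"
    and pos: "\<And>z. z \<in> \<bbbD> \<Longrightarrow> 0 < Re ((1 - z\<^sup>2) * deriv \<Phi> z)"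
  shows "connected {z \<in> \<bbbD>. Re (\<Phi> z) = c}"
proof -
  let ?S = "horizontal_strip (pi / 4)"
  have d: "((\<lambda>w. \<Phi> (tanh w)) has_field_derivative deriv \<Phi> (tanh w) * (1 - (tanh w)\<^sup>2)) (at w)"
    and mem: "tanh w \<in> \<bbbD>" if "w \<in> ?S" for w
  proof -
    show mem: "tanh w \<in> \<bbbD>" using that tanh_horizontal_strip by blast
    show "((\<lambda>w. \<Phi> (tanh w)) has_field_derivative deriv \<Phi> (tanh w) * (1 - (tanh w)\<^sup>2)) (at w)"
      by (rule DERIV_chain2[OF holomorphic_derivI[OF hol open_ball mem] has_field_derivative_tanh_strip[OF that]])
  qed
  interpret Re_deriv_pos_strip "\<lambda>w. \<Phi> (tanh w)" "pi / 4"
  proof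
    show "(\<lambda>w. \<Phi> (tanh w)) holomorphic_on ?S"
      using d by (meson holomorphic_onI has_field_derivative_at_within field_differentiable_def)
    show "0 < Re (deriv (\<lambda>w. \<Phi> (tanh w)) w)" if "w \<in> ?S" for w
      using DERIV_imp_deriv[OF d[OF that]] pos[OF mem[OF that]] by (simp add: mult.commute)
  qed
  have "continuous_on ?S tanh"
    by (intro continuous_at_imp_continuous_on ballI DERIV_isCont[OF has_field_derivative_tanh_strip])
  then have "continuous_on {w \<in> ?S. Re (\<Phi> (tanh w)) = c} tanh"
    by (rule continuous_on_subset) auto
  then have "connected (tanh ` {w \<in> ?S. Re (\<Phi> (tanh w)) = c})"
    using connected_Re_level_set connected_continuous_image by blast
  moreover have "tanh ` {w \<in> ?S. Re (\<Phi> (tanh w)) = c} = {z \<in> \<bbbD>. Re (\<Phi> z) = c}"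
    by (auto simp flip: tanh_horizontal_strip)
  ultimately show ?thesis by simp
qed

section \<open>Hadamard products\<close>

lemma holomorphic_disc_sums:
  assumes "f holomorphic_on \<bbbD>" "z \<in> \<bbbD>"
  shows "(\<lambda>n. fps_nth (fps_expansion f 0) n * z ^ n) sums f z"
  using holomorphic_power_series[OF assms] by (simp add: fps_expansion_def)

text \<open>The factor \<open>z\<close> undoes the index shift of differentiation, so coefficients
  are just multiplied by \<open>n\<close>.\<close>

lemma holomorphic_disc_deriv_sums:
  assumes hol: "f holomorphic_on \<bbbD>" and z: "z \<in> \<bbbD>"
  shows "(\<lambda>n. of_nat n * fps_nth (fps_expansion f 0) n * z ^ n) sums (z * deriv f z)"
proof -
  have "f has_fps_expansion fps_expansion f 0"
    by (rule has_fps_expansion_fps_expansion[OF open_ball _ hol]) simp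
  then have "(\<lambda>z. z * deriv f z) has_fps_expansion fps_X * fps_deriv (fps_expansion f 0)"
    by (intro has_fps_expansion_mult has_fps_expansion_fps_X has_fps_expansion_deriv)
  then have eq: "fps_expansion (\<lambda>z. z * deriv f z) 0 = fps_X * fps_deriv (fps_expansion f 0)"
    by (rule fps_expansion_eqI)
  have "(\<lambda>z. z * deriv f z) holomorphic_on \<bbbD>"
    using hol by (intro holomorphic_intros) auto
  from holomorphic_disc_sums[OF this z] show ?thesis
  proof (rule sums_cong[THEN iffD1, rotated])
    show "fps_nth (fps_expansion (\<lambda>z. z * deriv f z) 0) n * z ^ n
        = of_nat n * fps_nth (fps_expansion f 0) n * z ^ n" for n
      unfolding eq by (cases n) auto
  qed
qed

text \<open>For \<open>r < 1\<close> write \<open>r = s * s\<close>: the terms of one series at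
  \<open>s\<close> are bounded and the other series converges absolutely at
  \<open>s\<close>.\<close>

lemma hadamard_prod_conv_radius:
  assumes p: "p holomorphic_on \<bbbD>" and q: "q holomorphic_on \<bbbD>"
  shows "1 \<le> fps_conv_radius (Abs_fps (\<lambda>n. fps_nth (fps_expansion p 0) n * fps_nth (fps_expansion q 0) n))"
proof -
  let ?a = "fps_nth (fps_expansion p 0)" and ?b = "fps_nth (fps_expansion q 0)"
  have "1 \<le> conv_radius (\<lambda>n. ?a n * ?b n)"
  proof (rule conv_radius_geI_ex')
    fix r :: real assume r: "0 < r" "ereal r < 1"
    define s where "s = sqrt r"
    have r1: "r < 1" using r by (simp add: one_ereal_def)
    have s: "0 < s" "s < 1" "s * s = r" using r r1 by (auto simp: s_def)
    \<comment> \<open>Convergence at a point \<open>t\<close> beyond \<open>s\<close> gives absolute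
      convergence at \<open>s\<close>.\<close>
    define t where "t = (s + 1) / 2"
    have t: "s < t" "t < 1" "0 < t" using s by (auto simp: t_def)
    have "summable (\<lambda>n. ?a n * of_real s ^ n)"
      using holomorphic_disc_sums[OF p, of "of_real s"] s by (auto simp: summable_def)
    then have "Bseq (\<lambda>n. ?a n * of_real s ^ n)"
      by (intro convergent_imp_Bseq convergentI[of _ 0] summable_LIMSEQ_zero)
    then obtain B where B: "0 < B" "\<And>n. norm (?a n * of_real s ^ n) \<le> B" by (auto elim: BseqE)
    have "summable (\<lambda>n. ?b n * of_real t ^ n)"
      using holomorphic_disc_sums[OF q, of "of_real t"] t by (auto simp: summable_def)
    then have "summable (\<lambda>n. norm (?b n * of_real s ^ n))"
      by (rule powser_insidea) (use s t in auto)
    then have "summable (\<lambda>n. B * norm (?b n * of_real s ^ n))" by (rule summable_mult)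
    then show "summable (\<lambda>n. ?a n * ?b n * of_real r ^ n)"
    proof (rule summable_comparison_test'[where N = 0])
      fix n
      have "?a n * ?b n * of_real r ^ n = (?a n * of_real s ^ n) * (?b n * of_real s ^ n)"
        unfolding s(3)[symmetric] by (simp add: power_mult_distrib)
      then show "norm (?a n * ?b n * of_real r ^ n) \<le> B * norm (?b n * of_real s ^ n)"
        using mult_right_mono[OF B(2)[of n], of "norm (?b n * of_real s ^ n)"]
        by (simp only: norm_mult) simp
    qed
  qed
  then show ?thesis by (simp add: fps_conv_radius_def)
qed

lemma holomorphic_hadamard_prod:
  assumes "p holomorphic_on \<bbbD>" "q holomorphic_on \<bbbD>"
  shows "hadamard_prod p q holomorphic_on \<bbbD>"
  unfolding hadamard_prod_def
proof (rule holomorphic_on_eval_fps)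
  show "\<bbbD> \<subseteq> eball 0 (fps_conv_radius
      (Abs_fps (\<lambda>n. fps_nth (fps_expansion p 0) n * fps_nth (fps_expansion q 0) n)))"
  proof
    fix z :: complex assume "z \<in> \<bbbD>"
    then have "ereal (norm z) < 1" by (simp add: one_ereal_def)
    also note hadamard_prod_conv_radius[OF assms]
    finally show "z \<in> eball 0 (fps_conv_radius
      (Abs_fps (\<lambda>n. fps_nth (fps_expansion p 0) n * fps_nth (fps_expansion q 0) n)))"
      by (simp add: eball_def)
  qed
qed

lemma fps_expansion_hadamard_prod:
  assumes "p holomorphic_on \<bbbD>" "q holomorphic_on \<bbbD>"
  shows "fps_nth (fps_expansion (hadamard_prod p q) 0) n
    = fps_nth (fps_expansion p 0) n * fps_nth (fps_expansion q 0) n"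
proof -
  have "0 < fps_conv_radius (Abs_fps (\<lambda>n. fps_nth (fps_expansion p 0) n * fps_nth (fps_expansion q 0) n))"
    using hadamard_prod_conv_radius[OF assms] by (rule less_le_trans[rotated]) simp
  from fps_expansion_eqI[OF eval_fps_has_fps_expansion[OF this]]
  show ?thesis unfolding hadamard_prod_def by simp
qed

text \<open>The numerator times the conjugate denominator has real part
  \<open>(norm x)\<^sup>2 - (norm y)\<^sup>2\<close>. For \<open>x = h'\<close> and
  \<open>y = g'\<close> this turns sense-preservation into positivity.\<close>

lemma Re_shear_quotient_pos:
  fixes x y :: complex
  assumes "norm y < norm x"
  shows "0 < Re ((x + y) / (x - y))"
proof -
  have "(norm y)\<^sup>2 < (norm x)\<^sup>2" using assms by (simp add: power_strict_mono)
  then have "0 < Re ((x + y) * cnj (x - y))"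
    unfolding cmod_power2 by (simp add: power2_eq_square algebra_simps)
  then show ?thesis by (simp add: Re_complex_div_gt_0)
qed

lemma fps_expansion_disc_eqI:
  assumes "\<And>z. z \<in> \<bbbD> \<Longrightarrow> (\<lambda>n. c n * z ^ n) sums f z"
  shows "fps_nth (fps_expansion f 0) n = c n"
proof -
  have "f has_fps_expansion Abs_fps c"
  proof (rule has_fps_expansionI)
    have "\<forall>\<^sub>F z in nhds 0. z \<in> \<bbbD>" by (intro eventually_nhds_in_open) auto
    then show "\<forall>\<^sub>F z in nhds 0. (\<lambda>n. fps_nth (Abs_fps c) n * z ^ n) sums f z"
      by eventually_elim (use assms in auto)
  qed
  then show ?thesis using fps_expansion_eqI[of f "Abs_fps c"] by simp
qed

lemma fps_expansion_add_diff_disc: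
  assumes "f holomorphic_on \<bbbD>" "g holomorphic_on \<bbbD>"
  shows "fps_expansion (\<lambda>z. f z + g z) 0 = fps_expansion f 0 + fps_expansion g 0"
    and "fps_expansion (\<lambda>z. f z - g z) 0 = fps_expansion f 0 - fps_expansion g 0"
  using assms
  by (auto intro!: fps_expansion_eqI has_fps_expansion_add has_fps_expansion_diff
        has_fps_expansion_fps_expansion[OF open_ball])

lemma sums_odd_geometric:
  fixes z :: complex
  assumes "z \<in> \<bbbD>"
  shows "(\<lambda>n. (z ^ n - (- z) ^ n) / 2) sums (z / (1 - z\<^sup>2))"
proof -
  have z1: "1 - z \<noteq> 0" "1 + z \<noteq> 0" using assms by (auto simp: add_eq_0_iff)
  have "(\<lambda>n. (z ^ n - (- z) ^ n) / 2) sums ((1 / (1 - z) - 1 / (1 - - z)) / 2)"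
    using assms by (intro sums_divide sums_diff geometric_sums) auto
  also have "(1 / (1 - z) - 1 / (1 - - z)) / 2 = z / ((1 - z) * (1 + z))"
    using z1 by (simp add: diff_frac_eq)
  also have "(1 - z) * (1 + z) = 1 - z\<^sup>2" by (simp add: power2_eq_square algebra_simps)
  finally show ?thesis .
qed

section \<open>The derivative of the sum of the analytic parts of the convolution\<close>

lemma deriv_half_log_Cayley:
  assumes "z \<in> \<bbbD>"
  shows "((\<lambda>z. 1 / 2 * Ln ((1 + z) / (1 - z))) has_field_derivative 1 / (1 - z\<^sup>2)) (at z)"
proof -
  have z1: "1 - z \<noteq> 0" "1 + z \<noteq> 0" using assms by (auto simp: add_eq_0_iff)
  \<comment> \<open>The quotient lies in the right half-plane, off the branch cut of
    \<open>Ln\<close>.\<close>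
  have "(1 + z) / (1 - z) \<notin> \<real>\<^sub>\<le>\<^sub>0"
    using Cayley_Re_pos[of z] assms by (auto simp: complex_nonpos_Reals_iff)
  moreover have "((\<lambda>z. (1 + z) / (1 - z)) has_field_derivative 2 / (1 - z)\<^sup>2) (at z)"
    using z1 by (auto intro!: derivative_eq_intros simp: power2_eq_square field_simps)
  ultimately have "((\<lambda>z. 1 / 2 * Ln ((1 + z) / (1 - z))) has_field_derivative
      1 / 2 * (inverse ((1 + z) / (1 - z)) * (2 / (1 - z)\<^sup>2))) (at z)"
    by (intro DERIV_cmult DERIV_chain2[OF has_field_derivative_Ln])
  also have "1 / 2 * (inverse ((1 + z) / (1 - z)) * (2 / (1 - z)\<^sup>2)) = 1 / ((1 - z) * (1 + z))"
  proof -
    have "1 / 2 * (inverse (y / x) * (2 / x\<^sup>2)) = 1 / (x * y)" if "x \<noteq> 0" "y \<noteq> 0" for x y :: complex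
      using that by (simp add: field_simps power2_eq_square)
    then show ?thesis using z1 by blast
  qed
  also have "(1 - z) * (1 + z) = 1 - z\<^sup>2" by (simp add: power2_eq_square algebra_simps)
  finally show ?thesis .
qed

text \<open>Comparison of coefficients: \<open>a n - b n = 1\<close> for positive \<open>n\<close>,
  and \<open>n * (A n + B n)\<close> is 1 for odd and 0 for even \<open>n\<close>, so multiplication
  by it extracts the odd part of \<open>h1 + g1\<close>.\<close>

lemma deriv_hadamard_shear:
  assumes hol: "h1 holomorphic_on \<bbbD>" "g1 holomorphic_on \<bbbD>" "h2 holomorphic_on \<bbbD>" "g2 holomorphic_on \<bbbD>"
    and phi1: "\<And>z. z \<in> \<bbbD> \<Longrightarrow> h1 z - g1 z = z / (1 - z)"
    and phi2: "\<And>z. z \<in> \<bbbD> \<Longrightarrow> h2 z + g2 z = 1 / 2 * Ln ((1 + z) / (1 - z))"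
    and z: "z \<in> \<bbbD>"
  shows "2 * (z * deriv (\<lambda>z. hadamard_prod h1 h2 z + hadamard_prod g1 g2 z) z)
    = z * (deriv h2 z - deriv g2 z) + ((h1 z + g1 z) - (h1 (- z) + g1 (- z))) / 2"
proof -
  define a b A B where "a = fps_nth (fps_expansion h1 0)" and "b = fps_nth (fps_expansion g1 0)"
    and "A = fps_nth (fps_expansion h2 0)" and "B = fps_nth (fps_expansion g2 0)"
  let ?\<Phi> = "\<lambda>z. hadamard_prod h1 h2 z + hadamard_prod g1 g2 z"
  note had = holomorphic_hadamard_prod[OF hol(1,3)] holomorphic_hadamard_prod[OF hol(2,4)]
  have ab: "a n - b n = 1" if "0 < n" for n
  proof -
    have "a n - b n = fps_nth (fps_expansion (\<lambda>z. h1 z - g1 z) 0) n"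
      by (simp add: a_def b_def fps_expansion_add_diff_disc hol)
    also have "\<dots> = (if n = 0 then 0 else 1)"
    proof (rule fps_expansion_disc_eqI)
      fix z :: complex assume z: "z \<in> \<bbbD>"
      have "(\<lambda>n. z * z ^ n) sums (z * (1 / (1 - z)))"
        using z by (intro sums_mult geometric_sums) simp
      then have "(\<lambda>n. (if Suc n = 0 then 0 else 1) * z ^ Suc n) sums (z / (1 - z))" by simp
      then have "(\<lambda>n. (if n = 0 then 0 else 1) * z ^ n) sums (z / (1 - z))"
        by (subst (asm) sums_Suc_iff) simp
      then show "(\<lambda>n. (if n = 0 then 0 else 1) * z ^ n) sums (h1 z - g1 z)" using phi1[OF z] by simp
    qed
    finally show ?thesis using that by simp
  qed
  have AB: "of_nat n * (A n + B n) = (1 - (- 1) ^ n) / 2" for n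
  proof -
    have hol2: "(\<lambda>z. h2 z + g2 z) holomorphic_on \<bbbD>" using hol by (intro holomorphic_intros)
    have d: "deriv (\<lambda>z. h2 z + g2 z) z = 1 / (1 - z\<^sup>2)" if "z \<in> \<bbbD>" for z
    proof -
      have "\<forall>\<^sub>F z in nhds z. z \<in> \<bbbD>" using that by (intro eventually_nhds_in_open) auto
      then have "\<forall>\<^sub>F z in nhds z. h2 z + g2 z = 1 / 2 * Ln ((1 + z) / (1 - z))"
        by eventually_elim (rule phi2)
      then show ?thesis
        using deriv_cong_ev[OF _ refl] DERIV_imp_deriv[OF deriv_half_log_Cayley[OF that]] by metis
    qed
    have s1: "(\<lambda>n. of_nat n * (A n + B n) * z ^ n) sums (z / (1 - z\<^sup>2))" if "z \<in> \<bbbD>" for z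
      using holomorphic_disc_deriv_sums[OF hol2 that] d[OF that]
      by (simp add: A_def B_def fps_expansion_add_diff_disc hol)
    have s2: "(\<lambda>n. (1 - (- 1) ^ n) / 2 * z ^ n) sums (z / (1 - z\<^sup>2))" if "z \<in> \<bbbD>" for z
    proof -
      have "(1 - (- 1) ^ n) / 2 * z ^ n = (z ^ n - (- z) ^ n) / 2" for n
        by (simp add: power_minus[of z] left_diff_distrib)
      then show ?thesis using sums_odd_geometric[OF that] by simp
    qed
    show ?thesis using fps_expansion_disc_eqI[OF s1] fps_expansion_disc_eqI[OF s2] by metis
  qed
  have c: "fps_nth (fps_expansion ?\<Phi> 0) n = a n * A n + b n * B n" for n
    by (simp add: a_def b_def A_def B_def fps_expansion_add_diff_disc had fps_expansion_hadamard_prod hol)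
  have "(\<lambda>n. 2 * (of_nat n * (a n * A n + b n * B n) * z ^ n)) sums (2 * (z * deriv ?\<Phi> z))"
    using holomorphic_disc_deriv_sums[OF holomorphic_on_add[OF had] z] unfolding c by (rule sums_mult)
  moreover have "(\<lambda>n. of_nat n * (A n - B n) * z ^ n + ((a n + b n) * z ^ n - (a n + b n) * (- z) ^ n) / 2)
    sums (z * (deriv h2 z - deriv g2 z) + ((h1 z + g1 z) - (h1 (- z) + g1 (- z))) / 2)"
  proof (intro sums_add sums_divide sums_diff)
    show "(\<lambda>n. of_nat n * (A n - B n) * z ^ n) sums (z * (deriv h2 z - deriv g2 z))"
      using sums_diff[OF holomorphic_disc_deriv_sums[OF hol(3) z] holomorphic_disc_deriv_sums[OF hol(4) z]]
      by (simp add: A_def B_def algebra_simps)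
    have "(\<lambda>n. (a n + b n) * z ^ n) sums (h1 z + g1 z)" if "z \<in> \<bbbD>" for z
      using sums_add[OF holomorphic_disc_sums[OF hol(1) that] holomorphic_disc_sums[OF hol(2) that]]
      by (simp add: a_def b_def algebra_simps)
    then show "(\<lambda>n. (a n + b n) * z ^ n) sums (h1 z + g1 z)"
      "(\<lambda>n. (a n + b n) * (- z) ^ n) sums (h1 (- z) + g1 (- z))" using z by auto
  qed
  moreover have "2 * (of_nat n * (a n * A n + b n * B n) * z ^ n)
    = of_nat n * (A n - B n) * z ^ n + ((a n + b n) * z ^ n - (a n + b n) * (- z) ^ n) / 2" for n
  \<comment> \<open>\<open>ab\<close> covers positive \<open>n\<close>; at \<open>n = 0\<close> both
    sides are 0.\<close>
  proof (cases "n = 0")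
    case False
    have "((a n + b n) * z ^ n - (a n + b n) * (- z) ^ n) / 2 = (a n + b n) * ((1 - (- 1) ^ n) / 2) * z ^ n"
      by (simp add: power_minus[of z] field_simps)
    also have "\<dots> = (a n + b n) * (of_nat n * (A n + B n)) * z ^ n" by (simp only: AB)
    finally have eq: "((a n + b n) * z ^ n - (a n + b n) * (- z) ^ n) / 2
      = (a n + b n) * (of_nat n * (A n + B n)) * z ^ n" .
    have "2 * (a n * A n + b n * B n) = (a n - b n) * (A n - B n) + (a n + b n) * (A n + B n)"
      by (simp add: algebra_simps)
    also have "\<dots> = (A n - B n) + (a n + b n) * (A n + B n)" using ab[of n] False by simp
    finally have "of_nat n * (2 * (a n * A n + b n * B n)) * z ^ n
      = of_nat n * ((A n - B n) + (a n + b n) * (A n + B n)) * z ^ n" by simp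
    then show ?thesis unfolding eq by (simp add: algebra_simps)
  qed simp
  ultimately show ?thesis using sums_unique2 by simp
qed

text \<open>After division by \<open>z\<close>, \<open>deriv_hadamard_shear\<close> gives two terms.
  Multiplied by \<open>1 - z\<^sup>2\<close>, the first becomes
  \<open>(h2' - g2') / (h2' + g2')\<close>, and the second is covered by
  \<open>Re_odd_part_pos\<close> with \<open>k = h1 + g1\<close>.\<close>

lemma Re_deriv_hadamard_shear_pos:
  assumes hol: "h1 holomorphic_on \<bbbD>" "g1 holomorphic_on \<bbbD>" "h2 holomorphic_on \<bbbD>" "g2 holomorphic_on \<bbbD>"
    and phi1: "\<And>z. z \<in> \<bbbD> \<Longrightarrow> h1 z - g1 z = z / (1 - z)"
    and phi2: "\<And>z. z \<in> \<bbbD> \<Longrightarrow> h2 z + g2 z = 1 / 2 * Ln ((1 + z) / (1 - z))"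
    and sp1: "\<And>z. z \<in> \<bbbD> \<Longrightarrow> norm (deriv g1 z) < norm (deriv h1 z)"
    and sp2: "\<And>z. z \<in> \<bbbD> \<Longrightarrow> norm (deriv g2 z) < norm (deriv h2 z)"
    and at0: "deriv h1 0 = 1" "deriv g1 0 = 0" "deriv h2 0 = 1"
    and z: "z \<in> \<bbbD>"
  shows "0 < Re ((1 - z\<^sup>2) * deriv (\<lambda>z. hadamard_prod h1 h2 z + hadamard_prod g1 g2 z) z)"
proof (cases "z = 0")
  \<comment> \<open>Here division by \<open>z\<close> is impossible; the derivative at 0 is read off
    from the first coefficients and equals 1.\<close>
  case True
  note had = holomorphic_hadamard_prod[OF hol(1,3)] holomorphic_hadamard_prod[OF hol(2,4)]
  have coeff: "fps_nth (fps_expansion f 0) 1 = deriv f 0" for f by (simp add: fps_expansion_def)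
  have "deriv (\<lambda>z. hadamard_prod h1 h2 z + hadamard_prod g1 g2 z) 0
      = fps_nth (fps_expansion (hadamard_prod h1 h2) 0) 1 + fps_nth (fps_expansion (hadamard_prod g1 g2) 0) 1"
    unfolding coeff[symmetric] by (simp add: fps_expansion_add_diff_disc had)
  also have "\<dots> = deriv h1 0 * deriv h2 0 + deriv g1 0 * deriv g2 0"
    unfolding fps_expansion_hadamard_prod[OF hol(1,3)] fps_expansion_hadamard_prod[OF hol(2,4)]
    unfolding coeff ..
  finally show ?thesis using True at0 by simp
next
  case False
  define D where "D = deriv (\<lambda>z. hadamard_prod h1 h2 z + hadamard_prod g1 g2 z) z"
  define k where "k = (\<lambda>z. h1 z + g1 z)"
  have dh: "(f has_field_derivative deriv f w) (at w)" if "f holomorphic_on \<bbbD>" "w \<in> \<bbbD>" for f w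
    using holomorphic_derivI[OF that(1) open_ball that(2)] .
  have ev: "\<forall>\<^sub>F z in nhds w. z \<in> \<bbbD>" if "w \<in> \<bbbD>" for w :: complex
    using that by (intro eventually_nhds_in_open) auto
  have d1: "deriv h1 w - deriv g1 w = 1 / (1 - w)\<^sup>2" if w: "w \<in> \<bbbD>" for w
  proof -
    have "1 - w \<noteq> 0" using w by auto
    then have "((\<lambda>z. z / (1 - z)) has_field_derivative 1 / (1 - w)\<^sup>2) (at w)"
      by (auto intro!: derivative_eq_intros simp: power2_eq_square)
    moreover have "\<forall>\<^sub>F z in nhds w. h1 z - g1 z = z / (1 - z)"
      using ev[OF w] by eventually_elim (rule phi1)
    ultimately have "deriv (\<lambda>z. h1 z - g1 z) w = 1 / (1 - w)\<^sup>2"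
      using deriv_cong_ev[OF _ refl] DERIV_imp_deriv by metis
    then show ?thesis
      using DERIV_imp_deriv[OF DERIV_diff[OF dh[OF hol(1) w] dh[OF hol(2) w]]] by simp
  qed
  have d2: "deriv h2 z + deriv g2 z = 1 / (1 - z\<^sup>2)"
  proof -
    have "\<forall>\<^sub>F z in nhds z. h2 z + g2 z = 1 / 2 * Ln ((1 + z) / (1 - z))"
      using ev[OF z] by eventually_elim (rule phi2)
    then have "deriv (\<lambda>z. h2 z + g2 z) z = 1 / (1 - z\<^sup>2)"
      using deriv_cong_ev[OF _ refl] DERIV_imp_deriv[OF deriv_half_log_Cayley[OF z]] by metis
    then show ?thesis
      using DERIV_imp_deriv[OF DERIV_add[OF dh[OF hol(3) z] dh[OF hol(4) z]]] by simp
  qed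
  \<comment> \<open>By \<open>d1\<close> this is the quotient of \<open>h1' + g1'\<close> by
    \<open>h1' - g1'\<close>.\<close>
  have "0 < Re ((1 - w)\<^sup>2 * deriv k w)" if w: "w \<in> \<bbbD>" for w
  proof -
    have "deriv k w = deriv h1 w + deriv g1 w"
      using DERIV_imp_deriv[OF DERIV_add[OF dh[OF hol(1) w] dh[OF hol(2) w]]] by (simp add: k_def)
    then have "(1 - w)\<^sup>2 * deriv k w = (deriv h1 w + deriv g1 w) / (deriv h1 w - deriv g1 w)"
      unfolding d1[OF w] by simp
    then show ?thesis using Re_shear_quotient_pos[OF sp1[OF w]] by simp
  qed
  moreover have "k holomorphic_on \<bbbD>" unfolding k_def using hol by (intro holomorphic_intros)
  ultimately have p1: "0 < Re ((1 - z\<^sup>2) * (k z - k (- z)) / (2 * z))"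
    using Re_odd_part_pos z False by blast
  \<comment> \<open>Taking \<open>y = - g2'\<close> exchanges the roles of sum and
    difference.\<close>
  have "0 < Re ((deriv h2 z + - deriv g2 z) / (deriv h2 z - - deriv g2 z))"
    by (rule Re_shear_quotient_pos) (use sp2[OF z] in simp)
  then have p2: "0 < Re ((1 - z\<^sup>2) * (deriv h2 z - deriv g2 z))"
    using d2 by (simp add: mult.commute)
  have "2 * (z * D) = z * (deriv h2 z - deriv g2 z) + (k z - k (- z)) / 2"
    using deriv_hadamard_shear[OF hol phi1 phi2 z] by (simp add: D_def k_def)
  then have "2 * D = (deriv h2 z - deriv g2 z) + (k z - k (- z)) / (2 * z)"
    using False by (simp add: field_simps)
  then have "(1 - z\<^sup>2) * (2 * D)
      = (1 - z\<^sup>2) * (deriv h2 z - deriv g2 z) + (1 - z\<^sup>2) * (k z - k (- z)) / (2 * z)"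
    by (simp add: distrib_left)
  then have "0 < Re ((1 - z\<^sup>2) * (2 * D))" using p1 p2 by simp
  then have "0 < Re (2 * ((1 - z\<^sup>2) * D))" by (simp only: mult.left_commute)
  then show ?thesis unfolding D_def by simp
qed

section \<open>Convexity of the image in the direction of the imaginary axis\<close>

theorem theorem7:
  fixes f1 h1 g1 f2 h2 g2 :: "complex \<Rightarrow> complex"
  assumes "canonical_rep f1 h1 g1" and "canonical_rep f2 h2 g2"
    and "f1 \<in> class_SH0" and "f2 \<in> class_SH0"
    and "f1 \<in> class_WH (-1) (\<lambda>z. z / (1 - z))"
    and "f2 \<in> class_WH 1 (\<lambda>z. 1 / 2 * Ln ((1 + z) / (1 - z)))"
    and "locally_univalent_on (harmonic_conv h1 g1 h2 g2) \<bbbD>"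
  shows "convex_imag_dir (harmonic_conv h1 g1 h2 g2)"
proof -
  have hol: "h1 holomorphic_on \<bbbD>" "g1 holomorphic_on \<bbbD>" "h2 holomorphic_on \<bbbD>" "g2 holomorphic_on \<bbbD>"
    using assms(1,2) by (auto simp: canonical_rep_def intro: analytic_imp_holomorphic)
  \<comment> \<open>Two representations agree on a neighbourhood of each point of the disc, so their
    derivatives agree as well.\<close>
  have sense_preserving: "norm (deriv g z) < norm (deriv h z)"
    if "canonical_rep f h g" "f \<in> class_SH0" "z \<in> \<bbbD>" for f h g z
  proof -
    obtain h' g' where r: "canonical_rep f h' g'" "\<forall>z\<in>\<bbbD>. norm (deriv g' z) < norm (deriv h' z)"
      using \<open>f \<in> class_SH0\<close> by (auto simp: class_SH0_def)
    have ev: "\<forall>\<^sub>F z in nhds z. z \<in> \<bbbD>" using \<open>z \<in> \<bbbD>\<close> by (intro eventually_nhds_in_open) auto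
    have "\<forall>\<^sub>F z in nhds z. h z = h' z" "\<forall>\<^sub>F z in nhds z. g z = g' z"
      using ev by (eventually_elim, use canonical_rep_unique[OF that(1) r(1)] in blast)+
    then have "deriv h z = deriv h' z" "deriv g z = deriv g' z" by (auto intro!: deriv_cong_ev)
    then show ?thesis using r(2) \<open>z \<in> \<bbbD>\<close> by simp
  qed
  have shear: "h z + \<mu> * g z = \<phi> z"
    if "canonical_rep f h g" "f \<in> class_WH \<mu> \<phi>" "z \<in> \<bbbD>" for f h g \<mu> \<phi> z
  proof -
    obtain h' g' where r: "canonical_rep f h' g'" "\<forall>z\<in>\<bbbD>. h' z + \<mu> * g' z = \<phi> z"
      using \<open>f \<in> class_WH \<mu> \<phi>\<close> by (auto simp: class_WH_def)
    then show ?thesis using canonical_rep_unique[OF that(1) r(1) that(3)] that(3) by simp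
  qed
  have phi1: "h1 z - g1 z = z / (1 - z)" if "z \<in> \<bbbD>" for z
    using shear[OF assms(1,5) that] by simp
  have phi2: "h2 z + g2 z = 1 / 2 * Ln ((1 + z) / (1 - z))" if "z \<in> \<bbbD>" for z
    using shear[OF assms(2,6) that] by simp
  have at0: "deriv h1 0 = 1" "deriv g1 0 = 0" "deriv h2 0 = 1"
    using assms(1,2) by (auto simp: canonical_rep_def)
  define F where "F = harmonic_conv h1 g1 h2 g2"
  define \<Phi> where "\<Phi> = (\<lambda>z. hadamard_prod h1 h2 z + hadamard_prod g1 g2 z)"
  note had = holomorphic_hadamard_prod[OF hol(1,3)] holomorphic_hadamard_prod[OF hol(2,4)]
  have level: "connected {z \<in> \<bbbD>. Re (\<Phi> z) = x}" for x
  proof (rule connected_Re_level_disc)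
    show "\<Phi> holomorphic_on \<bbbD>" unfolding \<Phi>_def using had by (rule holomorphic_on_add)
    show "0 < Re ((1 - z\<^sup>2) * deriv \<Phi> z)" if "z \<in> \<bbbD>" for z
      unfolding \<Phi>_def
      by (rule Re_deriv_hadamard_shear_pos[OF hol phi1 phi2 sense_preserving[OF assms(1,3)]
            sense_preserving[OF assms(2,4)] at0 that])
  qed
  have Re_F: "Re (F z) = Re (\<Phi> z)" for z by (simp add: F_def \<Phi>_def harmonic_conv_def)
  have "continuous_on \<bbbD> (\<lambda>z. hadamard_prod h1 h2 z + cnj (hadamard_prod g1 g2 z))"
    by (intro continuous_intros holomorphic_on_imp_continuous_on had)
  then have cont: "continuous_on \<bbbD> F" by (simp add: F_def harmonic_conv_def[abs_def])
  \<comment> \<open>\<open>F\<close> is continuous and locally injective, so invariance of domain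
    gives openness.\<close>
  have "open (F ` \<bbbD>)"
  proof (subst open_subopen, intro ballI)
    fix w assume "w \<in> F ` \<bbbD>"
    then obtain z where z: "z \<in> \<bbbD>" "w = F z" by blast
    then obtain U where U: "open U" "z \<in> U" "U \<subseteq> \<bbbD>" "inj_on F U"
      using assms(7) unfolding locally_univalent_on_def F_def[symmetric] by blast
    then have "open (F ` U)"
      using cont by (intro invariance_of_domain) (auto intro: continuous_on_subset)
    then show "\<exists>T. open T \<and> w \<in> T \<and> T \<subseteq> F ` \<bbbD>" using U z by blast
  qed
  moreover have "connected (F ` \<bbbD>)" using cont by (intro connected_continuous_image) auto
  moreover have "connected (F ` \<bbbD> \<inter> {w. Re w = x})" for x
  proof -
    have "F ` \<bbbD> \<inter> {w. Re w = x} = F ` {z \<in> \<bbbD>. Re (\<Phi> z) = x}" using Re_F by auto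
    moreover have "continuous_on {z \<in> \<bbbD>. Re (\<Phi> z) = x} F" using cont by (rule continuous_on_subset) auto
    ultimately show ?thesis using connected_continuous_image[OF _ level] by simp
  qed
  ultimately show ?thesis
    unfolding convex_imag_dir_def domain_convex_imag_dir_def F_def[symmetric] by simp
qed

end
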